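(* Let $d\ge 1$, and let $\Phi=\{\phi_i(x)=\rho R_i x+a_i\}_{i=1}^N$ be an iterated function system on $\mathbb{R}^d$, where $N>1$, $0<\rho<1$, $R_i$ are orthogonal transformations on $\mathbb{R}^d$ and $a_i\in\mathbb{R}^d$ for $i=1,\dots,N$. Let $E$ be the attractor of $\Phi$. Suppose that $\Phi$ satisfies the open set condition, but does not satisfy the strong separation condition. Then $E$ cannot be generated by any iterated function system of similitudes on $\mathbb{R}^d$ satisfying the strong separation condition; that is, there is no iterated function system $\Psi$ of similitudes on $\mathbb{R}^d$ such that $\Psi$ satisfies the strong separation condition and the attractor of $\Psi$ is $E$.
   Context: An iterated function system (IFS) of similitudes on $\mathbb{R}^d$ is a finite family $\Phi=\{\phi_i\}_{i=1}^N$ with $N>1$ of maps $\phi_i(x)=\rho_i R_i x+a_i$, where $0<\rho_i<1$, $R_i$ is an orthogonal transformation on $\mathbb{R}^d$ and $a_i\in\mathbb{R}^d$ (the $\rho_i$ may differ from one another). Its attractor is the unique non-empty compact set $E\subset\mathbb{R}^d$ with $E=\bigcup_{i=1}^N\phi_i(E)$; one says that $\Phi$ generates $E$. $\Phi$ satisfies the open set condition (OSC) if there is a non-empty open set $U\subset\mathbb{R}^d$ such that $\phi_i(U)$, $i=1,\dots,N$, are pairwise disjoint subsets of $U$. $\Phi$ satisfies the strong separation condition (SSC) if the sets $\phi_i(E)$, $i=1,\dots,N$, are pairwise disjoint, where $E$ is the attractor of $\Phi$. *)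

theory Defs
  imports "HOL-Analysis.Analysis"
begin

text \<open>
  A finite family of maps is represented by its length \<open>N\<close> and a function \<open>\<phi>\<close> of which
  only the values \<open>\<phi> 1, \<dots>, \<phi> N\<close> matter.
\<close>

definition similitude :: "(real ^ 'd \<Rightarrow> real ^ 'd) \<Rightarrow> bool" where
  "similitude f \<longleftrightarrow>
     (\<exists>\<rho> R a. 0 < \<rho> \<and> \<rho> < 1 \<and> orthogonal_transformation R \<and> (\<forall>x. f x = \<rho> *\<^sub>R R x + a))"

definition ifs_similitudes :: "nat \<Rightarrow> (nat \<Rightarrow> real ^ 'd \<Rightarrow> real ^ 'd) \<Rightarrow> bool" where
  "ifs_similitudes N \<phi> \<longleftrightarrow> N > 1 \<and> (\<forall>i\<in>{1..N}. similitude (\<phi> i))"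

definition is_attractor :: "nat \<Rightarrow> (nat \<Rightarrow> real ^ 'd \<Rightarrow> real ^ 'd) \<Rightarrow> (real ^ 'd) set \<Rightarrow> bool" where
  "is_attractor N \<phi> E \<longleftrightarrow> E \<noteq> {} \<and> compact E \<and> E = (\<Union>i\<in>{1..N}. \<phi> i ` E)"

text \<open>The description is justified by \<open>ex1_attractor\<close> below.\<close>

definition attractor :: "nat \<Rightarrow> (nat \<Rightarrow> real ^ 'd \<Rightarrow> real ^ 'd) \<Rightarrow> (real ^ 'd) set" where
  "attractor N \<phi> = (THE E. is_attractor N \<phi> E)"

text \<open>
  Disjointness is that of the indexed family: distinct indices give disjoint sets, so a
  map occurring twice violates both conditions.
\<close>

definition open_set_condition :: "nat \<Rightarrow> (nat \<Rightarrow> real ^ 'd \<Rightarrow> real ^ 'd) \<Rightarrow> bool" where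
  "open_set_condition N \<phi> \<longleftrightarrow>
     (\<exists>U. U \<noteq> {} \<and> open U \<and> (\<forall>i\<in>{1..N}. \<phi> i ` U \<subseteq> U) \<and>
          disjoint_family_on (\<lambda>i. \<phi> i ` U) {1..N})"

definition strong_separation_condition :: "nat \<Rightarrow> (nat \<Rightarrow> real ^ 'd \<Rightarrow> real ^ 'd) \<Rightarrow> bool" where
  "strong_separation_condition N \<phi> \<longleftrightarrow>
     disjoint_family_on (\<lambda>i. \<phi> i ` attractor N \<phi>) {1..N}"

lemma similitude_dist:
  assumes "similitude f"
  obtains \<rho> where "0 < \<rho>" "\<rho> < 1" "\<And>x y. dist (f x) (f y) = \<rho> * dist x y"
proof -
  obtain \<rho> R a where \<rho>: "0 < \<rho>" "\<rho> < 1" and R: "orthogonal_transformation R"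
    and f: "\<And>x. f x = \<rho> *\<^sub>R R x + a"
    using assms unfolding similitude_def by blast
  have "dist (f x) (f y) = \<rho> * dist x y" for x y
  proof -
    have "f x - f y = \<rho> *\<^sub>R R (x - y)"
      using R by (simp add: f orthogonal_transformation_def linear_diff scaleR_diff_right)
    then show ?thesis
      using R \<rho> by (simp add: dist_norm orthogonal_transformation_norm)
  qed
  with \<rho> that show thesis by blast
qed

lemma is_attractor_subset:
  assumes ifs: "ifs_similitudes N \<phi>" and E: "is_attractor N \<phi> E" and F: "is_attractor N \<phi> F"
  shows "E \<subseteq> F"
proof -
  have cF: "closed F" "F \<noteq> {}" and EU: "E = (\<Union>i\<in>{1..N}. \<phi> i ` E)"
    and FU: "F = (\<Union>i\<in>{1..N}. \<phi> i ` F)"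
    using E F by (auto simp: is_attractor_def compact_imp_closed)
  have "compact E" "E \<noteq> {}" using E by (auto simp: is_attractor_def)
  then obtain x where x: "x \<in> E" and max: "\<And>y. y \<in> E \<Longrightarrow> infdist y F \<le> infdist x F"
    using continuous_attains_sup[of E "\<lambda>y. infdist y F"] continuous_on_infdist[OF continuous_on_id]
    by blast
  obtain i y where i: "i \<in> {1..N}" and y: "y \<in> E" "x = \<phi> i y" using x EU by blast
  obtain c where c: "0 < c" "c < 1" "\<And>u v. dist (\<phi> i u) (\<phi> i v) = c * dist u v"
    using similitude_dist ifs i unfolding ifs_similitudes_def by metis
  obtain z where z: "z \<in> F" "infdist y F = dist y z"
    using infdist_attains_inf[OF cF] by blast
  have "\<phi> i z \<in> F" using FU i z by blast
  then have "infdist x F \<le> dist (\<phi> i y) (\<phi> i z)" using y by (auto intro: infdist_le)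
  also have "\<dots> = c * infdist y F" using c z by simp
  also have "\<dots> \<le> c * infdist x F" using max[OF y(1)] c by simp
  finally have "(1 - c) * infdist x F \<le> 0" by (simp add: algebra_simps)
  then have "infdist x F \<le> 0" using c by (simp add: mult_le_0_iff)
  then have "infdist w F = 0" if "w \<in> E" for w
    using max[OF that] infdist_nonneg[of w F] by linarith
  then show ?thesis using in_closed_iff_infdist_zero[OF cF] by blast
qed

lemma is_attractor_exists:
  assumes ifs: "ifs_similitudes N \<phi>"
  shows "\<exists>E. is_attractor N \<phi> E"
proof -
  let ?I = "{1..N}"
  have "\<exists>c. 0 < c \<and> c < 1 \<and> (\<forall>x y. dist (\<phi> i x) (\<phi> i y) = c * dist x y)" if "i \<in> ?I" for i
    using similitude_dist ifs that unfolding ifs_similitudes_def by metis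
  then obtain c where c: "\<And>i. i \<in> ?I \<Longrightarrow> 0 < c i \<and> c i < 1"
    and dc: "\<And>i x y. i \<in> ?I \<Longrightarrow> dist (\<phi> i x) (\<phi> i y) = c i * dist x y"
    by metis
  have ne: "?I \<noteq> {}" using ifs by (auto simp: ifs_similitudes_def)
  define r where "r = Max ((\<lambda>i. norm (\<phi> i 0) / (1 - c i)) ` ?I)"
  have r: "norm (\<phi> i 0) \<le> (1 - c i) * r" if "i \<in> ?I" for i
  proof -
    have "norm (\<phi> i 0) / (1 - c i) \<le> r" unfolding r_def using that by (intro Max_ge) auto
    then show ?thesis using c[OF that] by (simp add: field_simps)
  qed
  have r0: "0 \<le> r"
  proof -
    obtain i where i: "i \<in> ?I" using ne by blast
    have "0 \<le> (1 - c i) * r" using norm_ge_zero r[OF i] by (rule order_trans)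
    moreover have "0 < 1 - c i" using c[OF i] by simp
    ultimately show ?thesis by (simp add: zero_le_mult_iff)
  qed
  have ball: "\<phi> i x \<in> cball 0 r" if "i \<in> ?I" "x \<in> cball 0 r" for i x
  proof -
    have "norm (\<phi> i x) \<le> dist (\<phi> i x) (\<phi> i 0) + norm (\<phi> i 0)"
      by (metis dist_norm norm_triangle_sub add.commute)
    also have "\<dots> \<le> c i * r + (1 - c i) * r"
      using dc[OF that(1)] c[OF that(1)] r[OF that(1)] that(2) by (intro add_mono) auto
    finally show ?thesis by (simp add: algebra_simps)
  qed
  define A where "A = rec_nat (cball 0 r) (\<lambda>_ S. \<Union>i\<in>?I. \<phi> i ` S)"
  have A0: "A 0 = cball 0 r" and AS: "\<And>n. A (Suc n) = (\<Union>i\<in>?I. \<phi> i ` A n)"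
    by (simp_all add: A_def)
  have cont: "continuous_on S (\<phi> i)" if "i \<in> ?I" for i S
  proof -
    have "(c i)-lipschitz_on S (\<phi> i)"
      using dc[OF that] c[OF that] by (intro lipschitz_onI) auto
    then show ?thesis by (rule lipschitz_on_continuous_on)
  qed
  have comp: "compact (A n)" for n
    by (induction n) (auto simp: A0 AS intro!: compact_UN compact_continuous_image cont)
  have nonempty: "A n \<noteq> {}" for n
    using r0 ne by (induction n) (auto simp: A0 AS)
  have step: "A (Suc n) \<subseteq> A n" for n
  proof (induction n)
    case 0
    then show ?case unfolding AS A0 using ball by blast
  next
    case (Suc n)
    then show ?case by (subst AS, subst AS) blast
  qed
  have anti: "A n \<subseteq> A m" if "m \<le> n" for m n
    using that step by (rule lift_Suc_antimono_le[rotated])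
  define E where "E = \<Inter>(range A)"
  have "compact E" unfolding E_def using comp by (intro compact_Inter) auto
  moreover have "E \<noteq> {}"
    unfolding E_def using compact_nest[of A] comp nonempty anti by blast
  moreover have "(\<Union>i\<in>?I. \<phi> i ` E) \<subseteq> E"
  proof -
    have "\<phi> i y \<in> A n" if "i \<in> ?I" "y \<in> E" for i y n
    proof -
      have "\<phi> i y \<in> A (Suc n)" using that unfolding AS E_def by blast
      then show ?thesis using step by blast
    qed
    then show ?thesis by (auto simp: E_def)
  qed
  moreover have "E \<subseteq> (\<Union>i\<in>?I. \<phi> i ` E)"
  proof
    fix x assume "x \<in> E"
    then have "\<forall>n. \<exists>i. i \<in> ?I \<and> x \<in> \<phi> i ` A n"
      using AS unfolding E_def by blast
    then obtain k where k: "\<And>n. k n \<in> ?I \<and> x \<in> \<phi> (k n) ` A n" by metis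
    have "range k \<subseteq> ?I" using k by blast
    then have "finite (range k)" by (rule finite_subset) simp
    then obtain m where inf: "infinite {n. k n = k m}"
      using pigeonhole_infinite[of UNIV k] by auto
    let ?i = "k m"
    have i: "?i \<in> ?I" using k by blast
    obtain y where y: "x = \<phi> ?i y" using k by blast
    have inj: "\<phi> ?i u = \<phi> ?i v \<Longrightarrow> u = v" for u v
      using dc[OF i, of u v] c[OF i] by simp
    have "y \<in> A n" for n
    proof -
      obtain n' where n': "n' \<ge> n" "k n' = ?i"
        using inf unfolding infinite_nat_iff_unbounded_le by blast
      then have "x \<in> \<phi> ?i ` A n'" using k[of n'] by simp
      then have "y \<in> A n'" using y inj by blast
      then show ?thesis using anti[OF n'(1)] by blast
    qed
    then have "y \<in> E" by (simp add: E_def)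
    then show "x \<in> (\<Union>i\<in>?I. \<phi> i ` E)" using y i by blast
  qed
  ultimately show ?thesis unfolding is_attractor_def by blast
qed

lemma ex1_attractor:
  assumes "ifs_similitudes N \<phi>"
  shows "\<exists>!E. is_attractor N \<phi> E"
  using is_attractor_exists[OF assms] is_attractor_subset[OF assms] by (meson subset_antisym)

lemma is_attractor_attractor:
  assumes "ifs_similitudes N \<phi>"
  shows "is_attractor N \<phi> (attractor N \<phi>)"
  unfolding attractor_def using ex1_attractor[OF assms] by (rule theI')

end

theory Submission
  imports Defs
begin

text \<open>
  For \<open>\<epsilon> > 0\<close> let \<open>n \<epsilon>\<close> be the largest number of classes in a partition of \<open>E\<close> whose classes are
  pairwise more than \<open>\<epsilon>\<close> apart (\<open>class_number E \<epsilon>\<close>, with partitions encoded by colourings). Suppose that a family \<open>\<psi>\<close> with ratios \<open>r j\<close> generates \<open>E\<close> with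
  strong separation, and choose \<open>s\<close> with \<open>(\<Sum>j. r j powr s) = 1\<close>. For small \<open>\<epsilon>\<close> the pieces
  \<open>\<psi> j ` E\<close> do not interact, so \<open>n \<epsilon> \<ge> (\<Sum>j. n (\<epsilon> / r j))\<close>, i.e. \<open>g \<epsilon> = \<epsilon> powr s * n \<epsilon>\<close> is at least
  a weighted average of values of \<open>g\<close> at larger scales. Hence the infimum of \<open>g\<close> over a suitable
  compact window of scales bounds \<open>g\<close> from below at all smaller scales. On the other hand two pieces
  \<open>\<phi> p ` E\<close>, \<open>\<phi> q ` E\<close> meet, so at least one class is lost: \<open>n (\<rho> * \<epsilon>) \<le> N * n \<epsilon> - 1\<close>.
  The open set condition gives \<open>N * \<rho> powr s \<le> 1\<close>, whence \<open>g (\<rho> * \<epsilon>) \<le> g \<epsilon> - (\<rho> * \<epsilon>) powr s\<close>, which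
  undercuts the infimum once \<open>g \<epsilon>\<close> is close to it.
\<close>

section \<open>Induction on scales\<close>

text \<open>Passing from \<open>\<epsilon>\<close> to \<open>\<epsilon> / r i\<close> enlarges the
  scale by at least the fixed factor \<open>1 / q > 1\<close>, so finitely many steps lead from any
  scale below \<open>b\<close> into the window from \<open>b\<close> to \<open>b / c\<close>. The
  bound \<open>c \<le> r i\<close> keeps a step from jumping over the window. The induction is on
  \<open>n\<close> with \<open>b * q ^ n \<le> \<epsilon>\<close>.\<close>

lemma scale_induct [consumes 5, case_names window step]:
  fixes r :: "'i \<Rightarrow> real"
  assumes "finite I" and r: "\<forall>i\<in>I. c \<le> r i \<and> r i < 1" and c: "0 < c" "c < 1"
    and e: "0 < \<epsilon> \<and> \<epsilon> \<le> b / c"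
    and window: "\<And>\<epsilon>. b \<le> \<epsilon> \<Longrightarrow> \<epsilon> \<le> b / c \<Longrightarrow> P \<epsilon>"
    and step: "\<And>\<epsilon>. 0 < \<epsilon> \<Longrightarrow> \<epsilon> < b \<Longrightarrow> (\<And>i. i \<in> I \<Longrightarrow> P (\<epsilon> / r i)) \<Longrightarrow> P \<epsilon>"
  shows "P \<epsilon>"
proof -
  \<comment> \<open>Inserting \<open>c\<close> gives \<open>0 < q < 1\<close> even for empty
    \<open>I\<close>.\<close>
  define q where "q = Max (insert c (r ` I))"
  have q: "0 < q" "q < 1" and rq: "\<And>i. i \<in> I \<Longrightarrow> r i \<le> q"
    using assms(1) r c unfolding q_def by (auto simp: less_max_iff_disj Max_gr_iff)
  have b: "0 < b" using e c by (smt (verit) divide_nonpos_pos)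
  have *: "P \<epsilon>" if "b * q ^ n \<le> \<epsilon>" "0 < \<epsilon>" "\<epsilon> \<le> b / c" for n \<epsilon>
    using that
  proof (induction n arbitrary: \<epsilon>)
    case 0
    then show ?case using window by simp
  next
    case (Suc n)
    show ?case
    proof (cases "b \<le> \<epsilon>")
      case True
      then show ?thesis using window Suc.prems by blast
    next
      case False
      show ?thesis
      proof (rule step)
        fix i assume i: "i \<in> I"
        have ri: "0 < r i" using r i c by fastforce
        have "b * q ^ n * r i \<le> b * q ^ n * q"
          using rq[OF i] b q by (intro mult_left_mono) auto
        also have "\<dots> \<le> \<epsilon>" using Suc.prems(1) by (simp add: mult_ac)
        finally have "b * q ^ n \<le> \<epsilon> / r i" using ri by (simp add: field_simps)
        moreover have "\<epsilon> / r i \<le> b / c"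
          using False Suc.prems(2) r i c by (intro frac_le) auto
        ultimately show "P (\<epsilon> / r i)" using Suc.IH Suc.prems(2) ri by simp
      qed (use False Suc.prems in auto)
    qed
  qed
  obtain n where "q ^ n < \<epsilon> / b" using real_arch_pow_inv[of "\<epsilon> / b" q] e b q by auto
  then have "b * q ^ n \<le> \<epsilon>" using b by (simp add: field_simps)
  then show ?thesis using * e by blast
qed

lemma lower_ratio_exists:
  fixes r :: "'i \<Rightarrow> real"
  assumes "finite I" and "\<And>i. i \<in> I \<Longrightarrow> 0 < r i \<and> r i < 1"
  shows "\<exists>c>0. c < 1 \<and> (\<forall>i\<in>I. c \<le> r i \<and> r i < 1)"
proof -
  \<comment> \<open>The entry \<open>1/2\<close> forces \<open>c < 1\<close> and makes the minimum
    meaningful for empty \<open>I\<close>.\<close>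
  define c where "c = Min (insert (1/2) (r ` I))"
  have "0 < c" unfolding c_def using assms by (subst Min_gr_iff) auto
  moreover have "c \<le> 1/2" unfolding c_def using assms by (intro Min_le) auto
  moreover have "\<And>i. i \<in> I \<Longrightarrow> c \<le> r i" unfolding c_def using assms by (intro Min_le) auto
  ultimately show ?thesis using assms by (intro exI[of _ c]) auto
qed

text \<open>This solves the Moran equation by the intermediate value theorem: the sum is
  \<open>card I \<ge> 1\<close> at exponent 0 and drops below 1 at a large integer exponent.\<close>

lemma similarity_dimension_exists:
  fixes r :: "'i \<Rightarrow> real"
  assumes fin: "finite I" and ne: "I \<noteq> {}" and r: "\<And>i. i \<in> I \<Longrightarrow> 0 < r i \<and> r i < 1"
  shows "\<exists>s\<ge>0. (\<Sum>i\<in>I. r i powr s) = 1"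
proof -
  let ?h = "\<lambda>s. \<Sum>i\<in>I. r i powr s"
  have "(\<lambda>n. \<Sum>i\<in>I. r i ^ n) \<longlonglongrightarrow> (\<Sum>i\<in>I. 0)"
    using r by (intro tendsto_sum LIMSEQ_realpow_zero) (auto intro: less_imp_le)
  then have "eventually (\<lambda>n. (\<Sum>i\<in>I. r i ^ n) < 1) sequentially"
    by (rule order_tendstoD) simp
  then obtain n where "(\<Sum>i\<in>I. r i ^ n) < 1"
    by (auto simp: eventually_sequentially)
  moreover have "(\<Sum>i\<in>I. r i ^ n) = ?h (real n)"
    using r by (intro sum.cong refl) (simp add: powr_realpow)
  ultimately obtain t where t: "0 \<le> t" "?h t < 1"
    using of_nat_0_le_iff by metis
  have "?h 0 = real (card I)" using r by (simp add: less_imp_neq[symmetric])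
  moreover have "1 \<le> card I" using fin ne by (simp add: Suc_leI card_gt_0_iff)
  moreover have "\<forall>i\<in>I. r i \<noteq> 0" using r by force
  then have "continuous_on {0..t} ?h" by (intro continuous_intros) auto
  ultimately obtain s where "0 \<le> s" "?h s = 1"
    using IVT2'[of ?h t 1 0] t by auto
  then show ?thesis by blast
qed

section \<open>Counting separated classes\<close>

text \<open>Total boundedness covers \<open>S\<close> by finitely many balls of radius
  \<open>\<delta>/2\<close>, and each of them contains at most one point of a
  \<open>\<delta>\<close>-separated set.\<close>

lemma separated_card_bounded:
  fixes S :: "'a::metric_space set"
  assumes "compact S" and "0 < \<delta>"
  shows "\<exists>k. \<forall>X. X \<subseteq> S \<longrightarrow> finite X \<longrightarrow> pairwise (\<lambda>x y. \<delta> \<le> dist x y) X \<longrightarrow> card X \<le> k"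
proof -
  obtain K where K: "finite K" "S \<subseteq> (\<Union>z\<in>K. ball z (\<delta>/2))"
    using compact_eq_totally_bounded[of S] assms by (meson half_gt_zero)
  have "card X \<le> card K"
    if X: "X \<subseteq> S" and sep: "pairwise (\<lambda>x y. \<delta> \<le> dist x y) X" for X
  proof -
    have "\<exists>z. z \<in> K \<and> dist z x < \<delta>/2" if "x \<in> X" for x
    proof -
      have "x \<in> (\<Union>z\<in>K. ball z (\<delta>/2))" using K(2) X that by blast
      then show ?thesis by (simp only: UN_iff mem_ball Bex_def)
    qed
    then obtain z where z: "\<And>x. x \<in> X \<Longrightarrow> z x \<in> K \<and> dist (z x) x < \<delta>/2" by metis
    have "inj_on z X"
    proof (rule inj_onI, rule ccontr)
      fix x y assume "x \<in> X" "y \<in> X" "z x = z y" "x \<noteq> y"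
      then show False
        using z[of x] z[of y] pairwiseD[OF sep, of x y] dist_triangle_half_r[of "z x" x \<delta> y] by auto
    qed
    then show ?thesis using z K(1) by (intro card_inj_on_le) auto
  qed
  then show ?thesis by blast
qed

text \<open>Encoding a partition by a function makes it easy to restrict to a piece, to pull back
  along a map and to glue over several pieces.\<close>

definition scale_colouring :: "'a::metric_space set \<Rightarrow> real \<Rightarrow> ('a \<Rightarrow> nat) \<Rightarrow> bool" where
  "scale_colouring E \<epsilon> f \<longleftrightarrow> (\<forall>x\<in>E. \<forall>y\<in>E. dist x y \<le> \<epsilon> \<longrightarrow> f x = f y)"

text \<open>For compact \<open>E\<close> and \<open>0 < \<epsilon>\<close> the maximum is over a
  finite non-empty set. It is then the number of \<open>\<epsilon>\<close>-chain components of
  \<open>E\<close>, where two points belong together if a chain in \<open>E\<close> with steps of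
  length at most \<open>\<epsilon>\<close> joins them.\<close>

definition class_number :: "'a::metric_space set \<Rightarrow> real \<Rightarrow> nat" where
  "class_number E \<epsilon> = Max {card (f ` E) | f. scale_colouring E \<epsilon> f}"

context
  fixes E :: "'a::metric_space set" and \<epsilon> :: real
  assumes E: "compact E" and \<epsilon>: "0 < \<epsilon>"
begin

text \<open>One representative per colour yields an \<open>\<epsilon>\<close>-separated subset of
  \<open>E\<close>. Since finiteness of the set of colours is not known beforehand, the bound is
  first proved for its finite subsets.\<close>

lemma scale_colouring_bounded:
  "\<exists>k. \<forall>f. scale_colouring E \<epsilon> f \<longrightarrow> finite (f ` E) \<and> card (f ` E) \<le> k"
proof -
  obtain k where k: "\<And>X. \<lbrakk>X \<subseteq> E; finite X; pairwise (\<lambda>x y. \<epsilon> \<le> dist x y) X\<rbrakk> \<Longrightarrow> card X \<le> k"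
    using separated_card_bounded[OF E \<epsilon>] by metis
  have "finite (f ` E) \<and> card (f ` E) \<le> k" if f: "scale_colouring E \<epsilon> f" for f
  proof (rule finite_if_finite_subsets_card_bdd, goal_cases)
    case F: (1 F)
    then obtain X where X: "X \<subseteq> E" "finite X" "F = f ` X" "inj_on f X"
      by (metis finite_image_iff subset_image_inj)
    have "card X \<le> k"
    proof (rule k[OF X(1,2)], rule pairwiseI)
      fix x y assume "x \<in> X" "y \<in> X" "x \<noteq> y"
      then have "\<not> dist x y \<le> \<epsilon>" using f X unfolding scale_colouring_def inj_on_def by blast
      then show "\<epsilon> \<le> dist x y" by simp
    qed
    then show ?case using X by (simp add: card_image)
  qed
  then show ?thesis by blast
qed

lemma finite_class_numbers: "finite {card (f ` E) | f. scale_colouring E \<epsilon> f}"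
proof -
  obtain k where "\<forall>f. scale_colouring E \<epsilon> f \<longrightarrow> card (f ` E) \<le> k"
    using scale_colouring_bounded by metis
  then have "{card (f ` E) | f. scale_colouring E \<epsilon> f} \<subseteq> {..k}" by auto
  then show ?thesis by (rule finite_subset) simp
qed

lemma card_colours_le_class_number:
  assumes "scale_colouring E \<epsilon> f"
  shows "finite (f ` E)" "card (f ` E) \<le> class_number E \<epsilon>"
proof -
  show "finite (f ` E)" using assms scale_colouring_bounded by metis
  show "card (f ` E) \<le> class_number E \<epsilon>"
    unfolding class_number_def using assms by (intro Max_ge finite_class_numbers) auto
qed

lemma class_number_attained:
  obtains f where "scale_colouring E \<epsilon> f" "card (f ` E) = class_number E \<epsilon>"
proof -
  have "scale_colouring E \<epsilon> (\<lambda>_. 0)" by (simp add: scale_colouring_def)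
  then have "{card (f ` E) | f. scale_colouring E \<epsilon> f} \<noteq> {}" by blast
  from Max_in[OF finite_class_numbers this]
  have "\<exists>f. class_number E \<epsilon> = card (f ` E) \<and> scale_colouring E \<epsilon> f"
    unfolding class_number_def by simp
  with that show thesis by metis
qed

end

lemma separated_pieces_gap:
  fixes A :: "'i \<Rightarrow> 'a::heine_borel set"
  assumes "finite I" and "\<And>i. i \<in> I \<Longrightarrow> compact (A i)" and "disjoint_family_on A I"
  obtains b where "0 < b"
    "\<And>i j x y. \<lbrakk>i \<in> I; j \<in> I; i \<noteq> j; x \<in> A i; y \<in> A j\<rbrakk> \<Longrightarrow> b \<le> dist x y"
proof -
  have "\<exists>d>0. \<forall>x\<in>A i. \<forall>y\<in>A j. d \<le> dist x y" if "i \<in> I" "j \<in> I" "i \<noteq> j" for i j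
    using that assms separate_compact_closed[of "A i" "A j"]
    by (auto simp: disjoint_family_on_def compact_imp_closed)
  then obtain d where d: "\<And>i j. \<lbrakk>i \<in> I; j \<in> I; i \<noteq> j\<rbrakk> \<Longrightarrow> 0 < d i j"
    "\<And>i j x y. \<lbrakk>i \<in> I; j \<in> I; i \<noteq> j; x \<in> A i; y \<in> A j\<rbrakk> \<Longrightarrow> d i j \<le> dist x y"
    by metis
  \<comment> \<open>The entry \<open>1\<close> covers the case that there is no pair of distinct
    indices.\<close>
  let ?D = "insert 1 ((\<lambda>(i, j). d i j) ` (I \<times> I - Id))"
  have fin: "finite ?D" using assms(1) by auto
  have "0 < Min ?D" using fin d(1) by (subst Min_gr_iff) auto
  moreover have "Min ?D \<le> dist x y" if "i \<in> I" "j \<in> I" "i \<noteq> j" "x \<in> A i" "y \<in> A j" for i j x y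
  proof -
    have "Min ?D \<le> d i j" using fin that by (intro Min_le) auto
    then show ?thesis using d(2)[OF that] by simp
  qed
  ultimately show thesis using that by blast
qed

text \<open>An optimal colouring at scale \<open>\<epsilon> / r j\<close> is transported by
  \<open>\<psi> j\<close> to the \<open>j\<close>-th piece, and its colours are tagged with
  \<open>j\<close>. Different pieces are at least \<open>b > \<epsilon>\<close> apart, so the result
  is a colouring at scale \<open>\<epsilon>\<close>, and the tags make the numbers of colours add
  up.\<close>

lemma class_number_separated_pieces:
  fixes \<psi> :: "nat \<Rightarrow> 'a::metric_space \<Rightarrow> 'a"
  assumes E: "compact E" and J: "finite J" and EU: "E = (\<Union>j\<in>J. \<psi> j ` E)"
    and r: "\<And>j. j \<in> J \<Longrightarrow> 0 < r j"
    and sim: "\<And>j x y. j \<in> J \<Longrightarrow> dist (\<psi> j x) (\<psi> j y) = r j * dist x y"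
    and gap: "\<And>i j x y. \<lbrakk>i \<in> J; j \<in> J; i \<noteq> j; x \<in> \<psi> i ` E; y \<in> \<psi> j ` E\<rbrakk> \<Longrightarrow> b \<le> dist x y"
    and \<epsilon>: "0 < \<epsilon>" "\<epsilon> < b"
  shows "(\<Sum>j\<in>J. class_number E (\<epsilon> / r j)) \<le> class_number E \<epsilon>"
proof -
  have "\<exists>f. scale_colouring E (\<epsilon> / r j) f \<and> card (f ` E) = class_number E (\<epsilon> / r j)" if "j \<in> J" for j
    using class_number_attained[OF E, of "\<epsilon> / r j"] r[OF that] \<epsilon> by (metis divide_pos_pos)
  then obtain f where f: "\<And>j. j \<in> J \<Longrightarrow> scale_colouring E (\<epsilon> / r j) (f j)"
    and cf: "\<And>j. j \<in> J \<Longrightarrow> card (f j ` E) = class_number E (\<epsilon> / r j)"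
    by metis
  have "\<forall>x\<in>E. \<exists>j y. j \<in> J \<and> y \<in> E \<and> x = \<psi> j y" using EU by blast
  \<comment> \<open>\<open>k x\<close> is the piece containing \<open>x\<close> and
    \<open>h x\<close> its preimage in \<open>E\<close>.\<close>
  then obtain k h where kh: "\<And>x. x \<in> E \<Longrightarrow> k x \<in> J \<and> h x \<in> E \<and> x = \<psi> (k x) (h x)" by metis
  have near: "k x = k y" if "x \<in> E" "y \<in> E" "dist x y \<le> \<epsilon>" for x y
    using gap[of "k x" "k y" x y] kh[OF that(1)] kh[OF that(2)] that(3) \<epsilon> by force
  define g where "g x = prod_encode (k x, f (k x) (h x))" for x
  have g: "scale_colouring E \<epsilon> g"
    unfolding scale_colouring_def
  proof (intro ballI impI)
    fix x y assume xy: "x \<in> E" "y \<in> E" "dist x y \<le> \<epsilon>"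
    let ?j = "k x"
    have j: "?j \<in> J" "k y = ?j" using kh xy near by auto
    have "r ?j * dist (h x) (h y) = dist x y" using kh[OF xy(1)] kh[OF xy(2)] j sim by metis
    then have "dist (h x) (h y) \<le> \<epsilon> / r ?j" using r[OF j(1)] xy(3) by (simp add: field_simps)
    then show "g x = g y"
      using f[OF j(1)] kh xy j unfolding g_def scale_colouring_def by simp
  qed
  have "prod_encode ` (SIGMA j:J. f j ` E) \<subseteq> g ` E"
  proof clarify
    fix j y assume j: "j \<in> J" and y: "y \<in> E"
    let ?x = "\<psi> j y"
    have x: "?x \<in> E" using EU j y by blast
    \<comment> \<open>If \<open>?x\<close> lay in two pieces, the gap would give
      \<open>b \<le> dist ?x ?x = 0\<close>.\<close>
    have k: "k ?x = j"
      using gap[of "k ?x" j ?x ?x] kh[OF x] j y \<epsilon> by force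
    then have "r j * dist (h ?x) y = 0" using kh[OF x] sim[OF j, of "h ?x" y] by simp
    then have "h ?x = y" using r[OF j] by simp
    then have "prod_encode (j, f j y) = g ?x" using k by (simp add: g_def)
    then show "prod_encode (j, f j y) \<in> g ` E" using x by blast
  qed
  then have "card (SIGMA j:J. f j ` E) \<le> card (g ` E)"
    using card_colours_le_class_number(1)[OF E \<epsilon>(1) g]
    by (metis card_image card_mono inj_prod_encode)
  moreover have "finite (f j ` E)" if "j \<in> J" for j
    using card_colours_le_class_number(1)[OF E _ f[OF that]] r[OF that] \<epsilon> by simp
  then have "card (SIGMA j:J. f j ` E) = (\<Sum>j\<in>J. class_number E (\<epsilon> / r j))"
    using J cf by (subst card_SigmaI) auto
  ultimately show ?thesis
    using card_colours_le_class_number(2)[OF E \<epsilon>(1) g] by simp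
qed

text \<open>Pulling an optimal colouring at scale \<open>\<rho> * \<epsilon>\<close> back along
  \<open>\<phi> i\<close> gives a colouring at scale \<open>\<epsilon>\<close>, so each piece shows
  at most \<open>class_number E \<epsilon>\<close> colours. The colour of the common point
  \<open>z\<close> is counted for both \<open>p\<close> and \<open>q\<close>, which saves
  one.\<close>

lemma class_number_touching_pieces:
  fixes \<phi> :: "nat \<Rightarrow> 'a::metric_space \<Rightarrow> 'a"
  assumes E: "compact E" and I: "finite I" and EU: "E = (\<Union>i\<in>I. \<phi> i ` E)"
    and \<rho>: "0 < \<rho>" and sim: "\<And>i x y. i \<in> I \<Longrightarrow> dist (\<phi> i x) (\<phi> i y) = \<rho> * dist x y"
    and pq: "p \<in> I" "q \<in> I" "p \<noteq> q" "z \<in> \<phi> p ` E" "z \<in> \<phi> q ` E"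
    and \<epsilon>: "0 < \<epsilon>"
  shows "class_number E (\<rho> * \<epsilon>) + 1 \<le> card I * class_number E \<epsilon>"
proof -
  obtain f where f: "scale_colouring E (\<rho> * \<epsilon>) f" "card (f ` E) = class_number E (\<rho> * \<epsilon>)"
    using class_number_attained[OF E, of "\<rho> * \<epsilon>"] \<rho> \<epsilon> by auto
  define A where "A i = f ` \<phi> i ` E" for i
  have "scale_colouring E \<epsilon> (f \<circ> \<phi> i)" if i: "i \<in> I" for i
    unfolding scale_colouring_def
  proof (intro ballI impI)
    fix x y assume xy: "x \<in> E" "y \<in> E" "dist x y \<le> \<epsilon>"
    then have "\<phi> i x \<in> E" "\<phi> i y \<in> E" using EU i by blast+
    moreover have "dist (\<phi> i x) (\<phi> i y) \<le> \<rho> * \<epsilon>" using sim[OF i] xy(3) \<rho> by simp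
    ultimately show "(f \<circ> \<phi> i) x = (f \<circ> \<phi> i) y" using f(1) by (simp add: scale_colouring_def)
  qed
  from card_colours_le_class_number[OF E \<epsilon> this]
  have A: "finite (A i)" "card (A i) \<le> class_number E \<epsilon>" if "i \<in> I" for i
    using that by (simp_all add: A_def image_comp)
  have zp: "f z \<in> A p" "f z \<in> A q" using pq by (auto simp: A_def)
  have "f ` E = (\<Union>i\<in>I. A i)" unfolding A_def using EU by blast
  \<comment> \<open>The colour \<open>f z\<close> may be dropped from \<open>A p\<close>, because
    \<open>A q\<close> still supplies it.\<close>
  also have "\<dots> \<subseteq> (A p - {f z}) \<union> (\<Union>i\<in>I - {p}. A i)" using pq zp by blast
  finally have "card (f ` E) \<le> card ((A p - {f z}) \<union> (\<Union>i\<in>I - {p}. A i))"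
    using A I pq by (intro card_mono) auto
  also have "\<dots> \<le> card (A p - {f z}) + (\<Sum>i\<in>I - {p}. card (A i))"
    using I by (intro order_trans[OF card_Un_le] add_left_mono card_UN_le) auto
  also have "card (A p - {f z}) = card (A p) - 1" using zp by simp
  \<comment> \<open>The truncated subtraction is harmless, as \<open>A p\<close> contains
    \<open>f z\<close>.\<close>
  finally have "card (f ` E) + 1 \<le> card (A p) + (\<Sum>i\<in>I - {p}. card (A i))"
    using zp(1) A(1)[OF pq(1)] card_gt_0_iff[of "A p"] by (auto simp: Suc_le_eq)
  also have "\<dots> = (\<Sum>i\<in>I. card (A i))" using I pq by (simp add: sum.remove)
  also have "\<dots> \<le> card I * class_number E \<epsilon>" using A by (metis sum_bounded_above of_nat_id)
  finally show ?thesis using f(2) by simp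
qed

section \<open>The open set condition and the similarity dimension\<close>

text \<open>At scales in the window from \<open>1\<close> to \<open>1 / c\<close> compactness bounds
  the number of points. At smaller scales the packing is distributed over the pieces and pulled back
  by each \<open>\<psi> j\<close> to a packing at scale \<open>\<delta> / r j\<close>; the Moran
  equation then reproduces the same constant \<open>C\<close>.\<close>

lemma packing_near_attractor:
  fixes \<psi> :: "nat \<Rightarrow> 'a::euclidean_space \<Rightarrow> 'a"
  assumes E: "compact E" and J: "finite J" and EU: "E = (\<Union>j\<in>J. \<psi> j ` E)"
    and r: "\<And>j. j \<in> J \<Longrightarrow> 0 < r j \<and> r j < 1"
    and sim: "\<And>j x y. j \<in> J \<Longrightarrow> dist (\<psi> j x) (\<psi> j y) = r j * dist x y"
    and surj: "\<And>j. j \<in> J \<Longrightarrow> surj (\<psi> j)"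
    and s: "0 \<le> s" "(\<Sum>j\<in>J. r j powr s) = 1" and a: "0 < a" "0 \<le> D"
  shows "\<exists>C. \<forall>\<delta> X. 0 < \<delta> \<and> \<delta> \<le> 1 \<and> finite X \<and> (\<forall>x\<in>X. \<exists>e\<in>E. dist x e \<le> D * \<delta>)
      \<and> pairwise (\<lambda>x y. a * \<delta> \<le> dist x y) X \<longrightarrow> \<delta> powr s * card X \<le> C"
proof -
  obtain c where c: "0 < c" "c < 1" and rc: "\<forall>j\<in>J. c \<le> r j \<and> r j < 1"
    using lower_ratio_exists[OF J, of r] r by metis
  obtain B where B: "\<And>x. x \<in> E \<Longrightarrow> norm x \<le> B"
    using compact_imp_bounded[OF E] by (auto simp: bounded_iff)
  \<comment> \<open>For \<open>\<delta> \<le> 1 / c\<close>, points within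
    \<open>D * \<delta>\<close> of \<open>E\<close> lie in this ball.\<close>
  obtain k where k: "\<forall>X. X \<subseteq> cball (0::'a) (B + D / c) \<longrightarrow> finite X \<longrightarrow>
      pairwise (\<lambda>x y. a \<le> dist x y) X \<longrightarrow> card X \<le> k"
    using separated_card_bounded[OF compact_cball a(1), of "0::'a" "B + D / c"] by blast
  define packed where "packed \<delta> X \<longleftrightarrow> finite X \<and> (\<forall>x\<in>X. \<exists>e\<in>E. dist x e \<le> D * \<delta>)
      \<and> pairwise (\<lambda>x y. a * \<delta> \<le> dist x y) X" for \<delta> X
  define C where "C = (1 / c) powr s * k"
  have "\<forall>X. packed \<delta> X \<longrightarrow> \<delta> powr s * card X \<le> C" if "0 < \<delta>" "\<delta> \<le> 1" for \<delta>
  proof -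
    have "1 \<le> 1 / c" using c by simp
    then have "0 < \<delta> \<and> \<delta> \<le> 1 / c" using that by linarith
    with J rc c show ?thesis
    proof (induction rule: scale_induct)
      case (window \<delta>)
      show ?case
      proof (intro allI impI)
        fix X assume X: "packed \<delta> X"
        have "card X \<le> k"
        proof (rule k[rule_format])
          show "X \<subseteq> cball 0 (B + D / c)"
          proof
            fix x assume "x \<in> X"
            then obtain e where e: "e \<in> E" "dist x e \<le> D * \<delta>" using X by (auto simp: packed_def)
            have "D * \<delta> \<le> D * (1 / c)" using window a by (intro mult_left_mono) auto
            then have "norm x \<le> B + D / c"
              using B[OF e(1)] e(2) norm_triangle_sub[of x e] by (simp add: dist_norm)
            then show "x \<in> cball 0 (B + D / c)" by simp
          qed
        next
          have "a * 1 \<le> a * \<delta>" using window a by (intro mult_left_mono) auto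
          then show "pairwise (\<lambda>x y. a \<le> dist x y) X"
            using X by (auto simp: packed_def pairwise_def intro: order_trans)
        qed (use X in \<open>simp add: packed_def\<close>)
        moreover have "\<delta> powr s \<le> (1 / c) powr s" using window s by (intro powr_mono2) auto
        ultimately show "\<delta> powr s * card X \<le> C" unfolding C_def by (intro mult_mono) auto
      qed
    next
      case (step \<delta>)
      show ?case
      proof (intro allI impI)
        fix X assume X: "packed \<delta> X"
        define Y where "Y j = \<psi> j -` X \<inter> {y. \<exists>e\<in>E. dist y e \<le> D * (\<delta> / r j)}" for j
        have inj: "inj (\<psi> j)" if "j \<in> J" for j
          using sim[OF that] r[OF that] by (intro injI) (metis dist_eq_0_iff mult_eq_0_iff less_irrefl)
        have Y: "packed (\<delta> / r j) (Y j)" if j: "j \<in> J" for j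
        proof -
          have "finite (Y j)"
            using X inj[OF j] unfolding Y_def packed_def by (auto intro: finite_vimageI)
          moreover have "a * (\<delta> / r j) \<le> dist x y" if "x \<in> Y j" "y \<in> Y j" "x \<noteq> y" for x y
          proof -
            have "\<psi> j x \<noteq> \<psi> j y" using that(3) inj[OF j] by (simp add: inj_eq)
            then have "a * \<delta> \<le> dist (\<psi> j x) (\<psi> j y)"
              using that(1,2) X by (simp add: Y_def packed_def pairwise_def)
            then have "a * \<delta> \<le> r j * dist x y" using sim[OF j] by simp
            then show ?thesis using r[OF j] by (simp add: field_simps)
          qed
          ultimately show ?thesis by (auto simp: packed_def Y_def pairwise_def)
        qed
        have "X \<subseteq> (\<Union>j\<in>J. \<psi> j ` Y j)"
        proof
          fix x assume x: "x \<in> X"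
          then obtain e where e: "e \<in> E" "dist x e \<le> D * \<delta>" using X by (auto simp: packed_def)
          then obtain j e' where j: "j \<in> J" and e': "e' \<in> E" "e = \<psi> j e'" using EU by blast
          \<comment> \<open>The point \<open>x\<close> is only near \<open>E\<close>, so its
            preimage comes from surjectivity of \<open>\<psi> j\<close> on the whole space.\<close>
          obtain y where y: "x = \<psi> j y" using surj[OF j] by (metis surjD)
          have "dist y e' \<le> D * (\<delta> / r j)"
            using e(2) sim[OF j, of y e'] r[OF j] y e' by (simp add: field_simps)
          then show "x \<in> (\<Union>j\<in>J. \<psi> j ` Y j)" using j x y e' by (auto simp: Y_def)
        qed
        then have "card X \<le> card (\<Union>j\<in>J. \<psi> j ` Y j)"
          using J Y by (intro card_mono) (auto simp: packed_def)
        also have "\<dots> \<le> (\<Sum>j\<in>J. card (\<psi> j ` Y j))" using J by (rule card_UN_le)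
        also have "\<dots> \<le> (\<Sum>j\<in>J. card (Y j))"
          using Y by (intro sum_mono card_image_le) (auto simp: packed_def)
        finally have "real (card X) \<le> (\<Sum>j\<in>J. real (card (Y j)))"
          by (metis of_nat_le_iff of_nat_sum)
        then have "\<delta> powr s * card X \<le> (\<Sum>j\<in>J. \<delta> powr s * card (Y j))"
          by (simp add: mult_left_mono flip: sum_distrib_left)
        also have "\<dots> \<le> (\<Sum>j\<in>J. r j powr s * C)"
        proof (rule sum_mono)
          fix j assume j: "j \<in> J"
          have "r j powr s * ((\<delta> / r j) powr s * card (Y j)) \<le> r j powr s * C"
            using step.IH[OF j] Y[OF j] by (intro mult_left_mono) auto
          then show "\<delta> powr s * card (Y j) \<le> r j powr s * C"
            using r[OF j] step.hyps by (simp add: powr_divide)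
        qed
        also have "\<dots> = C" using s by (simp flip: sum_distrib_right)
        finally show "\<delta> powr s * card X \<le> C" .
      qed
    qed
  qed
  then show ?thesis unfolding packed_def by blast
qed

lemma image_ball_similarity:
  fixes f :: "'a::metric_space \<Rightarrow> 'a"
  assumes "\<And>x y. dist (f x) (f y) = \<rho> * dist x y" "0 < \<rho>" "surj f"
  shows "f ` ball x t = ball (f x) (\<rho> * t)"
proof -
  have "f -` ball (f x) (\<rho> * t) = ball x t" using assms(1,2) by auto
  then show ?thesis using surj_image_vimage_eq[OF assms(3)] by metis
qed

text \<open>The set \<open>X\<close> consists of the images of \<open>x0\<close> under all
  compositions of \<open>n\<close> maps of the family. The balls around these points are carried
  along to keep points in different pieces apart, since those balls lie in disjoint images of
  \<open>U\<close>.\<close>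

lemma open_set_condition_packing:
  fixes \<phi> :: "nat \<Rightarrow> 'a::metric_space \<Rightarrow> 'a"
  assumes I: "finite I" and EU: "\<And>i. i \<in> I \<Longrightarrow> \<phi> i ` E \<subseteq> E" and e0: "e0 \<in> E"
    and \<rho>: "0 < \<rho>" and sim: "\<And>i x y. i \<in> I \<Longrightarrow> dist (\<phi> i x) (\<phi> i y) = \<rho> * dist x y"
    and surj: "\<And>i. i \<in> I \<Longrightarrow> surj (\<phi> i)"
    and UU: "\<And>i. i \<in> I \<Longrightarrow> \<phi> i ` U \<subseteq> U" and dU: "disjoint_family_on (\<lambda>i. \<phi> i ` U) I"
    and a: "0 < a" "ball x0 a \<subseteq> U"
  shows "\<exists>X. finite X \<and> card X = card I ^ n \<and> (\<forall>x\<in>X. ball x (a * \<rho> ^ n) \<subseteq> U)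
    \<and> (\<forall>x\<in>X. \<exists>e\<in>E. dist x e \<le> dist x0 e0 * \<rho> ^ n)
    \<and> pairwise (\<lambda>x y. a * \<rho> ^ n \<le> dist x y) X"
proof (induction n)
  case 0
  show ?case using a e0 by (intro exI[of _ "{x0}"]) auto
next
  case (Suc n)
  then obtain X where X: "finite X" "card X = card I ^ n"
    and ball: "\<And>x. x \<in> X \<Longrightarrow> ball x (a * \<rho> ^ n) \<subseteq> U"
    and near: "\<And>x. x \<in> X \<Longrightarrow> \<exists>e\<in>E. dist x e \<le> dist x0 e0 * \<rho> ^ n"
    and sep: "pairwise (\<lambda>x y. a * \<rho> ^ n \<le> dist x y) X"
    by blast
  define Z where "Z = (\<Union>i\<in>I. \<phi> i ` X)"
  have ballZ: "ball (\<phi> i x) (a * \<rho> ^ Suc n) \<subseteq> \<phi> i ` U" if "i \<in> I" "x \<in> X" for i x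
    using image_ball_similarity[of "\<phi> i" \<rho> x "a * \<rho> ^ n"] sim[OF that(1)] surj[OF that(1)] \<rho> ball[OF that(2)]
    by (metis image_mono mult.left_commute power_Suc)
  have pos: "0 < a * \<rho> ^ m" for m using a \<rho> by simp
  have XU: "x \<in> U" if "x \<in> X" for x using ball[OF that] pos by (meson centre_in_ball subsetD)
  have disj: "disjoint_family_on (\<lambda>i. \<phi> i ` X) I"
    using dU XU unfolding disjoint_family_on_def by blast
  have inj: "inj (\<phi> i)" if "i \<in> I" for i
    using sim[OF that] \<rho> by (intro injI) (metis dist_eq_0_iff mult_eq_0_iff less_irrefl)
  have "card Z = (\<Sum>i\<in>I. card (\<phi> i ` X))"
    unfolding Z_def using I X disj by (intro card_UN_disjoint) (auto simp: disjoint_family_on_def)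
  also have "\<dots> = (\<Sum>i\<in>I. card X)"
    using inj by (intro sum.cong refl card_image) (auto intro: inj_on_subset)
  finally have card: "card Z = card I ^ Suc n" using X by simp
  have nearZ: "\<exists>e\<in>E. dist z e \<le> dist x0 e0 * \<rho> ^ Suc n" if zZ: "z \<in> Z" for z
  proof -
    obtain i x where i: "i \<in> I" and x: "x \<in> X" "z = \<phi> i x" using zZ by (auto simp: Z_def)
    obtain e where e: "e \<in> E" "dist x e \<le> dist x0 e0 * \<rho> ^ n" using near[OF x(1)] by blast
    have "dist z (\<phi> i e) \<le> \<rho> * (dist x0 e0 * \<rho> ^ n)"
      using sim[OF i] e(2) \<rho> x by simp
    then show ?thesis using EU[OF i] e(1) by (auto simp: mult_ac)
  qed
  have sepZ: "pairwise (\<lambda>z w. a * \<rho> ^ Suc n \<le> dist z w) Z"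
  proof (rule pairwiseI)
    fix z w assume zw: "z \<in> Z" "w \<in> Z" "z \<noteq> w"
    obtain i x where i: "i \<in> I" and x: "x \<in> X" "z = \<phi> i x" using zw by (auto simp: Z_def)
    obtain j y where j: "j \<in> I" and y: "y \<in> X" "w = \<phi> j y" using zw by (auto simp: Z_def)
    show "a * \<rho> ^ Suc n \<le> dist z w"
    proof (cases "i = j")
      case True
      then have "\<rho> * (a * \<rho> ^ n) \<le> \<rho> * dist x y" using pairwiseD[OF sep, of x y] x y zw \<rho> by auto
      then show ?thesis using sim[OF i, of x y] True x y by (simp add: mult_ac)
    next
      case False
      \<comment> \<open>The point \<open>w\<close> lies in the image of \<open>U\<close> under
        \<open>\<phi> j\<close>, which is disjoint from the one under \<open>\<phi> i\<close>; the
        latter contains the ball around \<open>z\<close>.\<close>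
      then have "w \<notin> \<phi> i ` U" using dU i j XU[OF y(1)] y(2) unfolding disjoint_family_on_def by blast
      then have "w \<notin> ball z (a * \<rho> ^ Suc n)" using ballZ[OF i x(1)] x(2) by blast
      then show ?thesis by simp
    qed
  qed
  have "ball z (a * \<rho> ^ Suc n) \<subseteq> U" if "z \<in> Z" for z
    using that ballZ UU unfolding Z_def by blast
  moreover have "finite Z" using I X by (simp add: Z_def)
  ultimately show ?case using card nearZ sepZ by blast
qed

text \<open>The open set condition produces \<open>card I ^ n\<close> points separated at scale
  \<open>\<rho> ^ n\<close> near \<open>E\<close>, while the Moran equation for
  \<open>\<psi>\<close> bounds such packings. Hence all powers of
  \<open>card I * \<rho> powr s\<close> stay below one constant.\<close>

lemma open_set_condition_dimension_le:
  fixes \<phi> \<psi> :: "nat \<Rightarrow> 'a::euclidean_space \<Rightarrow> 'a"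
  assumes E: "compact E" "E \<noteq> {}" and I: "finite I" and EI: "E = (\<Union>i\<in>I. \<phi> i ` E)"
    and \<rho>: "0 < \<rho>" "\<rho> < 1" and simI: "\<And>i x y. i \<in> I \<Longrightarrow> dist (\<phi> i x) (\<phi> i y) = \<rho> * dist x y"
    and surjI: "\<And>i. i \<in> I \<Longrightarrow> surj (\<phi> i)"
    and U: "U \<noteq> {}" "open U" "\<And>i. i \<in> I \<Longrightarrow> \<phi> i ` U \<subseteq> U" "disjoint_family_on (\<lambda>i. \<phi> i ` U) I"
    and J: "finite J" and EJ: "E = (\<Union>j\<in>J. \<psi> j ` E)"
    and r: "\<And>j. j \<in> J \<Longrightarrow> 0 < r j \<and> r j < 1"
    and simJ: "\<And>j x y. j \<in> J \<Longrightarrow> dist (\<psi> j x) (\<psi> j y) = r j * dist x y"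
    and surjJ: "\<And>j. j \<in> J \<Longrightarrow> surj (\<psi> j)"
    and s: "0 \<le> s" "(\<Sum>j\<in>J. r j powr s) = 1"
  shows "card I * \<rho> powr s \<le> 1"
proof -
  obtain x0 a where a: "0 < a" "ball x0 a \<subseteq> U" using U(1,2) by (meson all_not_in_conv open_contains_ball)
  obtain e0 where e0: "e0 \<in> E" using E by blast
  have "\<exists>C. \<forall>\<delta> X. 0 < \<delta> \<and> \<delta> \<le> 1 \<and> finite X \<and> (\<forall>x\<in>X. \<exists>e\<in>E. dist x e \<le> dist x0 e0 * \<delta>)
      \<and> pairwise (\<lambda>x y. a * \<delta> \<le> dist x y) X \<longrightarrow> \<delta> powr s * card X \<le> C"
    by (rule packing_near_attractor[where \<psi> = \<psi> and J = J and r = r]) (fact zero_le_dist | fact)+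
  then obtain C where C: "\<And>\<delta> X. 0 < \<delta> \<and> \<delta> \<le> 1 \<and> finite X \<and> (\<forall>x\<in>X. \<exists>e\<in>E. dist x e \<le> dist x0 e0 * \<delta>)
      \<and> pairwise (\<lambda>x y. a * \<delta> \<le> dist x y) X \<Longrightarrow> \<delta> powr s * card X \<le> C"
    by blast
  have bound: "(card I * \<rho> powr s) ^ n \<le> C" for n
  proof -
    have EI': "\<And>i. i \<in> I \<Longrightarrow> \<phi> i ` E \<subseteq> E" using EI by blast
    have "\<exists>X. finite X \<and> card X = card I ^ n \<and> (\<forall>x\<in>X. ball x (a * \<rho> ^ n) \<subseteq> U)
      \<and> (\<forall>x\<in>X. \<exists>e\<in>E. dist x e \<le> dist x0 e0 * \<rho> ^ n) \<and> pairwise (\<lambda>x y. a * \<rho> ^ n \<le> dist x y) X"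
      by (rule open_set_condition_packing[where \<phi> = \<phi>]) fact+
    then obtain X where X: "finite X" "card X = card I ^ n"
      "\<forall>x\<in>X. \<exists>e\<in>E. dist x e \<le> dist x0 e0 * \<rho> ^ n"
      "pairwise (\<lambda>x y. a * \<rho> ^ n \<le> dist x y) X"
      by blast
    have "(\<rho> ^ n) powr s * card X \<le> C"
      using X \<rho> by (intro C conjI) (auto simp: power_le_one)
    moreover have "(\<rho> ^ n) powr s = (\<rho> powr s) ^ n"
      using \<rho> by (induction n) (auto simp: powr_mult)
    ultimately show ?thesis using X(2) by (simp add: power_mult_distrib mult.commute)
  qed
  show ?thesis
  proof (rule ccontr)
    assume "\<not> ?thesis"
    then obtain n where "C < (card I * \<rho> powr s) ^ n" using real_arch_pow[of "card I * \<rho> powr s" C] by auto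
    then show False using bound[of n] by simp
  qed
qed

section \<open>Touching pieces exclude strong separation\<close>

lemma touching_and_separated_pieces_contradiction:
  fixes \<phi> \<psi> :: "nat \<Rightarrow> 'a::heine_borel \<Rightarrow> 'a"
  assumes E: "compact E" and I: "finite I" and EI: "E = (\<Union>i\<in>I. \<phi> i ` E)"
    and \<rho>: "0 < \<rho>" "\<rho> < 1" and simI: "\<And>i x y. i \<in> I \<Longrightarrow> dist (\<phi> i x) (\<phi> i y) = \<rho> * dist x y"
    and pq: "p \<in> I" "q \<in> I" "p \<noteq> q" "z \<in> \<phi> p ` E" "z \<in> \<phi> q ` E"
    and J: "finite J" and EJ: "E = (\<Union>j\<in>J. \<psi> j ` E)"
    and r: "\<And>j. j \<in> J \<Longrightarrow> 0 < r j \<and> r j < 1"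
    and simJ: "\<And>j x y. j \<in> J \<Longrightarrow> dist (\<psi> j x) (\<psi> j y) = r j * dist x y"
    and disj: "disjoint_family_on (\<lambda>j. \<psi> j ` E) J"
    and s: "0 \<le> s" "(\<Sum>j\<in>J. r j powr s) = 1" and dim: "card I * \<rho> powr s \<le> 1"
  shows False
proof -
  have "compact (\<psi> j ` E)" if "j \<in> J" for j
  proof -
    have "(r j)-lipschitz_on E (\<psi> j)" using simJ[OF that] r[OF that] by (intro lipschitz_onI) auto
    then show ?thesis using E by (intro compact_continuous_image lipschitz_on_continuous_on)
  qed
  then obtain b where b: "0 < b"
    and gap: "\<And>i j x y. \<lbrakk>i \<in> J; j \<in> J; i \<noteq> j; x \<in> \<psi> i ` E; y \<in> \<psi> j ` E\<rbrakk> \<Longrightarrow> b \<le> dist x y"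
    using separated_pieces_gap[OF J _ disj] by metis
  obtain c where c: "0 < c" "c < 1" and rc: "\<forall>j\<in>J. c \<le> r j \<and> r j < 1"
    using lower_ratio_exists[OF J, of r] r by metis
  define g where "g \<epsilon> = \<epsilon> powr s * class_number E \<epsilon>" for \<epsilon>
  \<comment> \<open>Dividing a scale below \<open>b\<close> by some \<open>r j \<ge> c\<close> stays
    below \<open>b / c\<close>, so this window is the right one for
    \<open>scale_induct\<close>.\<close>
  define m where "m = Inf (g ` {b..b / c})"
  have bdd: "bdd_below (g ` {b..b / c})" by (intro bdd_belowI[of _ 0]) (auto simp: g_def)
  have bc: "b \<le> b / c" using b c by (simp add: field_simps)
  have lower: "m \<le> g \<epsilon>" if "0 < \<epsilon> \<and> \<epsilon> \<le> b / c" for \<epsilon>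
    using J rc c that
  proof (induction rule: scale_induct)
    case (window \<epsilon>)
    then show ?case unfolding m_def using bdd by (intro cInf_lower) auto
  next
    case (step \<epsilon>)
    \<comment> \<open>By the Moran equation the weights \<open>r j powr s\<close> sum to 1, so a
      lower bound at the scales \<open>\<epsilon> / r j\<close> passes to their weighted
      average.\<close>
    have "m = (\<Sum>j\<in>J. r j powr s * m)" using s by (simp flip: sum_distrib_right)
    also have "\<dots> \<le> (\<Sum>j\<in>J. r j powr s * g (\<epsilon> / r j))"
      using step.IH by (intro sum_mono mult_left_mono) auto
    also have "\<dots> = (\<Sum>j\<in>J. \<epsilon> powr s * class_number E (\<epsilon> / r j))"
      using r step.hyps by (intro sum.cong refl) (force simp: g_def powr_divide)
    also have "\<dots> = \<epsilon> powr s * real (\<Sum>j\<in>J. class_number E (\<epsilon> / r j))"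
      by (simp add: sum_distrib_left)
    also have "\<dots> \<le> g \<epsilon>"
    proof -
      have "\<And>j. j \<in> J \<Longrightarrow> 0 < r j" using r by blast
      then have "(\<Sum>j\<in>J. class_number E (\<epsilon> / r j)) \<le> class_number E \<epsilon>"
        using step.hyps by (intro class_number_separated_pieces[where \<psi> = \<psi> and b = b] E J EJ simJ gap)
      then show ?thesis unfolding g_def by (intro mult_left_mono) (auto simp del: of_nat_sum)
    qed
    finally show ?case .
  qed
  \<comment> \<open>The margin \<open>(\<rho> * b) powr s\<close> is a lower bound, uniform over the
    window, for the loss \<open>(\<rho> * \<epsilon>) powr s\<close> caused by the touching pieces.
    A scale whose value of \<open>g\<close> is within this margin of \<open>m\<close> therefore
    suffices.\<close>
  have "m < m + (\<rho> * b) powr s" using \<rho> b by simp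
  then obtain \<epsilon> where \<epsilon>: "b \<le> \<epsilon>" "\<epsilon> \<le> b / c" "g \<epsilon> < m + (\<rho> * b) powr s"
    unfolding m_def using bc by (subst (asm) cInf_less_iff[OF _ bdd]) auto
  have \<epsilon>0: "0 < \<epsilon>" using \<epsilon> b by simp
  have "class_number E (\<rho> * \<epsilon>) + 1 \<le> card I * class_number E \<epsilon>"
    by (rule class_number_touching_pieces[where \<phi> = \<phi> and p = p and q = q and z = z]) fact+
  then have "real (class_number E (\<rho> * \<epsilon>) + 1) \<le> real (card I * class_number E \<epsilon>)"
    by (simp only: of_nat_le_iff)
  then have "real (class_number E (\<rho> * \<epsilon>)) \<le> real (card I) * class_number E \<epsilon> - 1" by simp
  then have "g (\<rho> * \<epsilon>) \<le> (\<rho> * \<epsilon>) powr s * (real (card I) * class_number E \<epsilon> - 1)"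
    unfolding g_def by (intro mult_left_mono) auto
  also have "\<dots> = (card I * \<rho> powr s) * g \<epsilon> - (\<rho> * \<epsilon>) powr s"
    using \<rho> \<epsilon>0 by (simp add: g_def powr_mult algebra_simps)
  also have "\<dots> \<le> 1 * g \<epsilon> - (\<rho> * b) powr s"
    using dim \<rho> \<epsilon> b s by (intro diff_mono mult_right_mono powr_mono2) (auto simp: g_def)
  also have "\<dots> < m" using \<epsilon> by simp
  also have "m \<le> g (\<rho> * \<epsilon>)"
  proof (rule lower)
    have "\<rho> * \<epsilon> \<le> 1 * \<epsilon>" using \<rho> \<epsilon>0 by (intro mult_right_mono) auto
    then have "\<rho> * \<epsilon> \<le> b / c" using \<epsilon>(2) by linarith
    then show "0 < \<rho> * \<epsilon> \<and> \<rho> * \<epsilon> \<le> b / c" using \<rho> \<epsilon>0 by simp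
  qed
  finally show False by simp
qed

lemma similitude_surj:
  assumes "similitude f"
  shows "surj f"
proof -
  obtain \<rho> R a where \<rho>: "0 < \<rho>" and R: "orthogonal_transformation R" and f: "\<And>x. f x = \<rho> *\<^sub>R R x + a"
    using assms unfolding similitude_def by blast
  show ?thesis
  proof (rule surjI)
    fix y
    show "f (inv R ((1 / \<rho>) *\<^sub>R (y - a))) = y"
      using \<rho> surj_f_inv_f[OF orthogonal_transformation_surj[OF R]] by (simp add: f)
  qed
qed

theorem theorem1p2:
  fixes N :: nat and \<rho> :: real
    and R :: "nat \<Rightarrow> real ^ 'd \<Rightarrow> real ^ 'd" and a :: "nat \<Rightarrow> real ^ 'd"
    and \<phi> :: "nat \<Rightarrow> real ^ 'd \<Rightarrow> real ^ 'd" and E :: "(real ^ 'd) set"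
  assumes "N > 1" and "0 < \<rho>" and "\<rho> < 1"
    and "\<forall>i\<in>{1..N}. orthogonal_transformation (R i)"
    and "\<forall>i\<in>{1..N}. \<forall>x. \<phi> i x = \<rho> *\<^sub>R R i x + a i"
    and "E = attractor N \<phi>"
    and "open_set_condition N \<phi>"
    and "\<not> strong_separation_condition N \<phi>"
  shows "\<not> (\<exists>M (\<psi> :: nat \<Rightarrow> real ^ 'd \<Rightarrow> real ^ 'd).
            ifs_similitudes M \<psi> \<and> strong_separation_condition M \<psi> \<and> attractor M \<psi> = E)"
proof (intro notI, elim exE conjE)
  fix M and \<psi> :: "nat \<Rightarrow> real ^ 'd \<Rightarrow> real ^ 'd"
  assume \<psi>: "ifs_similitudes M \<psi>" "strong_separation_condition M \<psi>" "attractor M \<psi> = E"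
  let ?I = "{1..N}" and ?J = "{1..M}"
  have sim\<phi>: "similitude (\<phi> i)" if "i \<in> ?I" for i
    unfolding similitude_def using assms(2-5) that by blast
  then have "ifs_similitudes N \<phi>" using assms(1) by (simp add: ifs_similitudes_def)
  from is_attractor_attractor[OF this]
  have E: "compact E" "E \<noteq> {}" and EI: "E = (\<Union>i\<in>?I. \<phi> i ` E)"
    unfolding assms(6) is_attractor_def by blast+
  have EJ: "E = (\<Union>j\<in>?J. \<psi> j ` E)"
    using is_attractor_attractor[OF \<psi>(1)] \<psi>(3) unfolding is_attractor_def by blast
  have dist\<phi>: "dist (\<phi> i x) (\<phi> i y) = \<rho> * dist x y" if "i \<in> ?I" for i x y
  proof -
    have R: "orthogonal_transformation (R i)" using assms(4) that by blast
    have "\<phi> i x - \<phi> i y = \<rho> *\<^sub>R R i (x - y)"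
      using R assms(5) that
      by (simp add: orthogonal_transformation_def linear_diff scaleR_diff_right)
    then show ?thesis using R assms(2) by (simp add: dist_norm orthogonal_transformation_norm)
  qed
  have sim\<psi>: "similitude (\<psi> j)" if "j \<in> ?J" for j using \<psi>(1) that by (simp add: ifs_similitudes_def)
  then have "\<exists>t. (0 < t \<and> t < 1) \<and> (\<forall>x y. dist (\<psi> j x) (\<psi> j y) = t * dist x y)" if "j \<in> ?J" for j
    using similitude_dist that by metis
  then obtain r where r: "\<And>j. j \<in> ?J \<Longrightarrow> 0 < r j \<and> r j < 1"
    and dist\<psi>: "\<And>j x y. j \<in> ?J \<Longrightarrow> dist (\<psi> j x) (\<psi> j y) = r j * dist x y"
    by metis
  have "?J \<noteq> {}" using \<psi>(1) by (auto simp: ifs_similitudes_def)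
  then have "\<exists>s\<ge>0. (\<Sum>j\<in>?J. r j powr s) = 1"
    using r by (intro similarity_dimension_exists) auto
  then obtain s where s: "0 \<le> s" "(\<Sum>j\<in>?J. r j powr s) = 1" by blast
  obtain U where U: "U \<noteq> {}" "open U" "\<forall>i\<in>?I. \<phi> i ` U \<subseteq> U" "disjoint_family_on (\<lambda>i. \<phi> i ` U) ?I"
    using assms(7) unfolding open_set_condition_def by (elim exE conjE)
  \<comment> \<open>Here \<open>s\<close> solves the Moran equation of \<open>\<psi>\<close>,
    whereas \<open>N\<close> and \<open>\<rho>\<close> belong to \<open>\<phi>\<close>; the common
    attractor \<open>E\<close> links the two.\<close>
  have dim: "card ?I * \<rho> powr s \<le> 1"
    by (rule open_set_condition_dimension_le[where E = E and \<phi> = \<phi> and \<psi> = \<psi> and J = ?J and r = r and U = U])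
      (fact finite_atLeastAtMost | fact | rule similitude_surj sim\<phi> sim\<psi> U(3)[rule_format] | assumption)+
  obtain p q z where "p \<in> ?I" "q \<in> ?I" "p \<noteq> q" "z \<in> \<phi> p ` E" "z \<in> \<phi> q ` E"
    using assms(8) unfolding strong_separation_condition_def disjoint_family_on_def assms(6)[symmetric]
    by blast
  have "disjoint_family_on (\<lambda>j. \<psi> j ` E) ?J"
    using \<psi>(2,3) by (simp add: strong_separation_condition_def)
  show False
    by (rule touching_and_separated_pieces_contradiction[where \<phi> = \<phi> and \<psi> = \<psi> and I = ?I and J = ?J
          and r = r and p = p and q = q and z = z]) (fact finite_atLeastAtMost | fact)+
qed

end
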